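(* Let $\alpha=\sum_i r_i$ where $(r_i)$ is a computable sequence of positive rational numbers with convergent sum. Then $\alpha$ is Martin-Löf random if and only if the series converges slowly in the Solovay sense, i.e. there is $\varepsilon>0$ such that $r_i\ge\varepsilon\, m_i$ for infinitely many $i$ (equivalently, $\alpha$ is not random if and only if $r_i/m_i\to 0$).
   Context: A lower semicomputable semimeasure on $\mathbb{N}$ is a function $\mu:\mathbb{N}\to[0,\infty)$ such that $\mu(i)$ is lower semicomputable uniformly in $i$ and $\sum_i\mu(i)\le 1$. Fix a universal one $m$ (the a priori probability), i.e. a lower semicomputable semimeasure such that for every lower semicomputable semimeasure $\mu$ there is a constant $c$ with $\mu(i)\le c\,m(i)$ for all $i$; write $m_i=m(i)$. (Any computable convergent series of positive rationals satisfies $r_i=O(m_i)$.) *)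

theory Defs
  imports "HOL-Analysis.Analysis"
begin

text \<open>
  Total recursive functions in Kleene's sense: \<open>recursive_fn n f\<close> says that \<open>f\<close>, applied to
  argument lists of length \<open>n\<close>, is a total recursive function of \<open>n\<close> arguments. Values on lists
  of any other length are irrelevant. Minimisation is only applied where it yields a total function.
\<close>

inductive recursive_fn :: "nat \<Rightarrow> (nat list \<Rightarrow> nat) \<Rightarrow> bool" where
  zero: "recursive_fn n (\<lambda>xs. 0)"
| succ: "recursive_fn 1 (\<lambda>xs. Suc (xs ! 0))"
| proj: "i < n \<Longrightarrow> recursive_fn n (\<lambda>xs. xs ! i)"
| comp: "recursive_fn (length gs) f \<Longrightarrow> \<forall>g \<in> set gs. recursive_fn n g \<Longrightarrow>
    recursive_fn n (\<lambda>xs. f (map (\<lambda>g. g xs) gs))"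
| prim_rec: "recursive_fn n f \<Longrightarrow> recursive_fn (Suc (Suc n)) g \<Longrightarrow>
    recursive_fn (Suc n) (\<lambda>xs. rec_nat (f (tl xs)) (\<lambda>k v. g (k # v # tl xs)) (hd xs))"
| minimise: "recursive_fn (Suc n) f \<Longrightarrow> \<forall>xs. length xs = n \<longrightarrow> (\<exists>z. f (z # xs) = 0) \<Longrightarrow>
    recursive_fn n (\<lambda>xs. LEAST z. f (z # xs) = 0)"

text \<open>A rational is represented by naturals \<open>a, b, c\<close> as \<open>(a - b) / (c + 1)\<close>.\<close>

definition computable_rat_fn :: "nat \<Rightarrow> (nat list \<Rightarrow> rat) \<Rightarrow> bool" where
  "computable_rat_fn n f \<longleftrightarrow>
    (\<exists>a b c. recursive_fn n a \<and> recursive_fn n b \<and> recursive_fn n c \<and>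
      (\<forall>xs. length xs = n \<longrightarrow>
        f xs = (of_nat (a xs) - of_nat (b xs)) / of_nat (Suc (c xs))))"

definition computable_rat_seq :: "(nat \<Rightarrow> rat) \<Rightarrow> bool" where
  "computable_rat_seq r \<longleftrightarrow> computable_rat_fn 1 (\<lambda>xs. r (xs ! 0))"

definition computable_rat_seq2 :: "(nat \<Rightarrow> nat \<Rightarrow> rat) \<Rightarrow> bool" where
  "computable_rat_seq2 q \<longleftrightarrow> computable_rat_fn 2 (\<lambda>xs. q (xs ! 0) (xs ! 1))"

text \<open>
  \<open>\<mu> i\<close> is lower semicomputable uniformly in \<open>i\<close>: it is the limit of a nondecreasing
  sequence of rationals that is computable uniformly in \<open>i\<close>.
\<close>

definition lower_semicomputable :: "(nat \<Rightarrow> real) \<Rightarrow> bool" where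
  "lower_semicomputable \<mu> \<longleftrightarrow>
    (\<exists>q. computable_rat_seq2 q \<and>
      (\<forall>i. incseq (q i) \<and> (\<lambda>t. real_of_rat (q i t)) \<longlonglongrightarrow> \<mu> i))"

definition lsc_semimeasure :: "(nat \<Rightarrow> real) \<Rightarrow> bool" where
  "lsc_semimeasure \<mu> \<longleftrightarrow>
    (\<forall>i. 0 \<le> \<mu> i) \<and> lower_semicomputable \<mu> \<and> summable \<mu> \<and> (\<Sum>i. \<mu> i) \<le> 1"

definition universal_semimeasure :: "(nat \<Rightarrow> real) \<Rightarrow> bool" where
  "universal_semimeasure m \<longleftrightarrow>
    lsc_semimeasure m \<and>
    (\<forall>\<mu>. lsc_semimeasure \<mu> \<longrightarrow> (\<exists>c. \<forall>i. \<mu> i \<le> c * m i))"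

text \<open>
  Uniformly effectively open sets of reals are enumerated by a computable double sequence of open
  intervals with rational endpoints; an interval is empty if its endpoints are not in
  increasing order, so that finite and empty enumerations are included.
\<close>

definition uniformly_effectively_open :: "(nat \<Rightarrow> real set) \<Rightarrow> bool" where
  "uniformly_effectively_open U \<longleftrightarrow>
    (\<exists>a b. computable_rat_seq2 a \<and> computable_rat_seq2 b \<and>
      (\<forall>n. U n = (\<Union>k. {real_of_rat (a n k) <..< real_of_rat (b n k)})))"

definition martin_loef_test :: "(nat \<Rightarrow> real set) \<Rightarrow> bool" where
  "martin_loef_test U \<longleftrightarrow>
    uniformly_effectively_open U \<and> (\<forall>n. emeasure lborel (U n) \<le> ennreal (1 / 2 ^ n))"

definition martin_loef_random :: "real \<Rightarrow> bool" where
  "martin_loef_random x \<longleftrightarrow> (\<forall>U. martin_loef_test U \<longrightarrow> x \<notin> (\<Inter>n. U n))"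

definition solovay_slow :: "(nat \<Rightarrow> real) \<Rightarrow> (nat \<Rightarrow> rat) \<Rightarrow> bool" where
  "solovay_slow m r \<longleftrightarrow> (\<exists>\<epsilon>>0. \<exists>\<^sub>\<infinity>i. real_of_rat (r i) \<ge> \<epsilon> * m i)"

end

theory Submission imports Defs begin

text \<open>
  Let \<open>s i\<close> be the partial sums. If a test \<open>U\<close> captures \<open>\<alpha>\<close>, give \<open>i\<close> the mass \<open>2 ^ n * r i\<close> for
  every \<open>n\<close> such that \<open>(s i, s (i + 1))\<close> lies strictly inside one of the enumerated intervals of
  \<open>U (2 n + 1)\<close>. These gaps are disjoint, so the total mass is at most 1, and for each \<open>n\<close> almost all
  gaps are captured; hence \<open>r i / m i\<close> tends to 0.

  Conversely, suppose that \<open>r i < e * m i\<close> for \<open>i \<ge> T\<close>, with \<open>T\<close> unknown. Let \<open>W t\<close> be the mass of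
  \<open>{..<t}\<close> seen by time \<open>t\<close> in an enumeration of \<open>m\<close>. Only the indices below \<open>t\<close> count, so the growth of
  \<open>W\<close> after time \<open>T\<close> is at least the mass of \<open>{T..}\<close>, whence \<open>\<alpha> < s T + e * (W t - W T)\<close> for large
  \<open>t\<close>. A frontier that is advanced by \<open>e * (W (t + 1) - W t)\<close> at each step, and that is moved up to
  \<open>s t\<close> if it falls behind, thus passes \<open>\<alpha>\<close> during one of the advances, and the advances have total
  length at most \<open>e\<close>. No knowledge of \<open>T\<close> is needed, so this works uniformly in \<open>e = 2 ^ - (n + 2)\<close>.
\<close>

section \<open>Total recursive functions\<close>

text \<open>
  The predicate \<^const>\<open>recursive_fn\<close> fixes the values on lists of the wrong length; closing it under
  equality on lists of length \<open>n\<close> is what makes the rules below compositional. A bound variable is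
  the head of the argument list, so that the outer variables are accessed through \<^const>\<open>tl\<close>.
\<close>

definition total_recursive :: "nat \<Rightarrow> (nat list \<Rightarrow> nat) \<Rightarrow> bool" where
  "total_recursive n f \<longleftrightarrow> (\<exists>g. recursive_fn n g \<and> (\<forall>xs. length xs = n \<longrightarrow> f xs = g xs))"

lemma total_recursive_cong:
  assumes "total_recursive n f" "\<And>xs. length xs = n \<Longrightarrow> f' xs = f xs"
  shows "total_recursive n f'"
  using assms unfolding total_recursive_def by metis

lemma recursive_fn_imp_total_recursive: "recursive_fn n f \<Longrightarrow> total_recursive n f"
  unfolding total_recursive_def by blast

lemma total_recursive_nth: "i < n \<Longrightarrow> total_recursive n (\<lambda>xs. xs ! i)"
  by (simp add: recursive_fn.proj recursive_fn_imp_total_recursive)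

lemma total_recursive_comp:
  assumes f: "total_recursive (length gs) f" and gs: "\<And>g. g \<in> set gs \<Longrightarrow> total_recursive n g"
  shows "total_recursive n (\<lambda>xs. f (map (\<lambda>g. g xs) gs))"
proof -
  obtain f' where f': "recursive_fn (length gs) f'" "\<And>xs. length xs = length gs \<Longrightarrow> f xs = f' xs"
    using f unfolding total_recursive_def by blast
  \<comment> \<open>Each member of \<open>gs\<close> is replaced by a function that satisfies
    \<open>recursive_fn\<close> itself and has the same values on lists of length
    \<open>n\<close>.\<close>
  obtain h where h: "\<And>g. g \<in> set gs \<Longrightarrow> recursive_fn n (h g)"
      "\<And>g xs. g \<in> set gs \<Longrightarrow> length xs = n \<Longrightarrow> g xs = h g xs"
    using gs unfolding total_recursive_def by metis
  have "recursive_fn n (\<lambda>xs. f' (map (\<lambda>g. g xs) (map h gs)))"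
    by (rule recursive_fn.comp) (use f' h in auto)
  moreover have "f (map (\<lambda>g. g xs) gs) = f' (map (\<lambda>g. g xs) (map h gs))" if "length xs = n" for xs
    using f'(2)[of "map (\<lambda>g. g xs) gs"] h(2) that by (simp add: comp_def cong: map_cong)
  ultimately show ?thesis
    unfolding total_recursive_def by blast
qed

text \<open>Common source of the substitution rules below: the first \<open>k\<close> arguments are
  replaced by the values of \<open>gs\<close>, and the other \<open>n\<close> are passed on by
  projections.\<close>

lemma total_recursive_subst_drop:
  assumes f: "total_recursive (length gs + n) f"
    and gs: "\<And>g. g \<in> set gs \<Longrightarrow> total_recursive (n + k) g"
  shows "total_recursive (n + k) (\<lambda>xs. f (map (\<lambda>g. g xs) gs @ drop k xs))"
proof -
  let ?ps = "map (\<lambda>i xs :: nat list. xs ! (k + i)) [0..<n]"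
  have "total_recursive (n + k) (\<lambda>xs. f (map (\<lambda>g. g xs) (gs @ ?ps)))"
    by (rule total_recursive_comp) (use f gs in \<open>auto intro!: total_recursive_nth\<close>)
  moreover have "map (\<lambda>i. xs ! (k + i)) [0..<n] = drop k xs" if "length xs = n + k" for xs :: "nat list"
    using that by (intro nth_equalityI) auto
  ultimately show ?thesis
    by (elim total_recursive_cong) (simp add: comp_def)
qed

lemma total_recursive_Cons:
  assumes "total_recursive (Suc n) f" "total_recursive n g"
  shows "total_recursive n (\<lambda>xs. f (g xs # xs))"
  using total_recursive_subst_drop[of "[g]" n f 0] assms by simp

lemma total_recursive_Cons_tl:
  assumes "total_recursive (Suc n) f" "total_recursive (Suc n) g"
  shows "total_recursive (Suc n) (\<lambda>xs. f (g xs # tl xs))"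
  using total_recursive_subst_drop[of "[g]" n f 1] assms by (simp add: drop_Suc)

lemma total_recursive_Cons_tl_tl:
  assumes "total_recursive (Suc n) f" "total_recursive (Suc (Suc n)) g"
  shows "total_recursive (Suc (Suc n)) (\<lambda>xs. f (g xs # tl (tl xs)))"
  using total_recursive_subst_drop[of "[g]" n f 2] assms
  by (simp add: drop_Suc numeral_2_eq_2)

lemma total_recursive_tl:
  assumes "total_recursive n f"
  shows "total_recursive (Suc n) (\<lambda>xs. f (tl xs))"
  using total_recursive_subst_drop[of "[]" n f 1] assms by (simp add: drop_Suc)

lemma total_recursive_subst1:
  assumes "total_recursive 1 f" "total_recursive n g"
  shows "total_recursive n (\<lambda>xs. f [g xs])"
  using total_recursive_comp[of "[g]" f n] assms by simp

lemma total_recursive_subst2: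
  assumes "total_recursive 2 f" "total_recursive n g" "total_recursive n h"
  shows "total_recursive n (\<lambda>xs. f [g xs, h xs])"
  using total_recursive_comp[of "[g, h]" f n] assms by (auto simp: numeral_2_eq_2)

lemma total_recursive_nth_tl: "Suc i < n \<Longrightarrow> total_recursive n (\<lambda>xs. tl xs ! i)"
  by (rule total_recursive_cong[OF total_recursive_nth[of "Suc i"]]) (auto simp: nth_tl)

lemma total_recursive_nth_tl_tl:
  "Suc (Suc i) < n \<Longrightarrow> total_recursive n (\<lambda>xs. tl (tl xs) ! i)"
  by (rule total_recursive_cong[OF total_recursive_nth[of "Suc (Suc i)"]]) (auto simp: nth_tl)

lemma total_recursive_rec_nat:
  assumes b: "total_recursive n b" and f: "total_recursive n f"
    and g: "total_recursive (Suc (Suc n)) (\<lambda>ys. g (ys ! 0) (ys ! 1) (tl (tl ys)))"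
  shows "total_recursive n (\<lambda>xs. rec_nat (f xs) (\<lambda>k v. g k v xs) (b xs))"
proof -
  obtain f' where f': "recursive_fn n f'" "\<And>xs. length xs = n \<Longrightarrow> f xs = f' xs"
    using f unfolding total_recursive_def by blast
  obtain g' where g': "recursive_fn (Suc (Suc n)) g'"
      "\<And>ys. length ys = Suc (Suc n) \<Longrightarrow> g (ys ! 0) (ys ! 1) (tl (tl ys)) = g' ys"
    using g unfolding total_recursive_def by blast
  \<comment> \<open>The primitive recursion scheme recurses on the head of the list, so the bound
    \<open>b xs\<close> is put there by substitution.\<close>
  have "total_recursive (Suc n) (\<lambda>xs. rec_nat (f' (tl xs)) (\<lambda>k v. g' (k # v # tl xs)) (hd xs))"
    using recursive_fn.prim_rec[OF f'(1) g'(1)] by (rule recursive_fn_imp_total_recursive)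
  from total_recursive_Cons[OF this b]
  have *: "total_recursive n (\<lambda>xs. rec_nat (f' xs) (\<lambda>k v. g' (k # v # xs)) (b xs))"
    by simp
  have "rec_nat (f xs) (\<lambda>k v. g k v xs) (b xs) = rec_nat (f' xs) (\<lambda>k v. g' (k # v # xs)) (b xs)"
    if "length xs = n" for xs
  proof -
    have "g k v xs = g' (k # v # xs)" for k v
      using g'(2)[of "k # v # xs"] that by simp
    then show ?thesis
      using f'(2)[OF that] by simp
  qed
  then show ?thesis
    by (rule total_recursive_cong[OF *])
qed

section \<open>Arithmetic of recursive functions\<close>

lemma total_recursive_Suc:
  assumes "total_recursive n f"
  shows "total_recursive n (\<lambda>xs. Suc (f xs))"
  using total_recursive_subst1[OF recursive_fn_imp_total_recursive[OF recursive_fn.succ] assms]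
  by simp

lemma total_recursive_const: "total_recursive n (\<lambda>xs. c)"
  by (induction c)
    (auto intro: recursive_fn_imp_total_recursive recursive_fn.zero total_recursive_Suc)

lemma total_recursive_add:
  assumes "total_recursive n f" "total_recursive n g"
  shows "total_recursive n (\<lambda>xs. f xs + g xs)"
proof -
  have *: "rec_nat a (\<lambda>k v. Suc v) b = a + b" for a b :: nat
    by (induction b) auto
  have "total_recursive n (\<lambda>xs. rec_nat (f xs) (\<lambda>k v. Suc v) (g xs))"
    by (intro total_recursive_rec_nat assms total_recursive_Suc total_recursive_nth) simp
  then show ?thesis
    by (simp only: *)
qed

lemma total_recursive_sum:
  assumes "total_recursive n b" "total_recursive (Suc n) (\<lambda>ys. F (ys ! 0) (tl ys))"
  shows "total_recursive n (\<lambda>xs. \<Sum>i<b xs. F i xs)"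
proof -
  have *: "rec_nat 0 (\<lambda>k v. v + F k xs) b = (\<Sum>i<b. F i xs)" for xs b
    by (induction b) auto
  \<comment> \<open>In the recursion the accumulator stands between the counter and the parameters;
    the summand has to skip it.\<close>
  have "total_recursive (Suc (Suc n)) (\<lambda>ys. F (ys ! 0) (tl (tl ys)))"
    using total_recursive_Cons_tl_tl[OF assms(2) total_recursive_nth[of 0]] by simp
  then have "total_recursive n (\<lambda>xs. rec_nat 0 (\<lambda>k v. v + F k xs) (b xs))"
    by (intro total_recursive_rec_nat assms total_recursive_add total_recursive_nth
        total_recursive_const) auto
  then show ?thesis
    by (simp only: *)
qed

lemma total_recursive_mult:
  assumes "total_recursive n f" "total_recursive n g"
  shows "total_recursive n (\<lambda>xs. f xs * g xs)"
proof -
  have "total_recursive n (\<lambda>xs. \<Sum>i<f xs. g xs)"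
    by (intro total_recursive_sum assms total_recursive_tl)
  then show ?thesis
    by simp
qed

lemma total_recursive_prod:
  assumes "total_recursive n b" "total_recursive (Suc n) (\<lambda>ys. F (ys ! 0) (tl ys))"
  shows "total_recursive n (\<lambda>xs. \<Prod>i<b xs. F i xs)"
proof -
  have *: "rec_nat 1 (\<lambda>k v. v * F k xs) b = (\<Prod>i<b. F i xs)" for xs b
    by (induction b) auto
  have "total_recursive (Suc (Suc n)) (\<lambda>ys. F (ys ! 0) (tl (tl ys)))"
    using total_recursive_Cons_tl_tl[OF assms(2) total_recursive_nth[of 0]] by simp
  then have "total_recursive n (\<lambda>xs. rec_nat 1 (\<lambda>k v. v * F k xs) (b xs))"
    by (intro total_recursive_rec_nat assms total_recursive_mult total_recursive_nth
        total_recursive_const) auto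
  then show ?thesis
    by (simp only: *)
qed

lemma total_recursive_power:
  assumes "total_recursive n f" "total_recursive n g"
  shows "total_recursive n (\<lambda>xs. f xs ^ g xs)"
proof -
  have "total_recursive n (\<lambda>xs. \<Prod>i<g xs. f xs)"
    by (intro total_recursive_prod assms total_recursive_tl)
  then show ?thesis
    by simp
qed

text \<open>Truncated subtraction iterates the predecessor, which is in turn a recursion that
  returns its counter and ignores the previous value.\<close>

lemma total_recursive_diff:
  assumes "total_recursive n f" "total_recursive n g"
  shows "total_recursive n (\<lambda>xs. f xs - g xs)"
proof -
  have pred: "rec_nat 0 (\<lambda>k v. k) b = b - 1" for b :: nat
    by (induction b) auto
  have minus: "rec_nat a (\<lambda>k v. v - 1) b = a - b" for a b :: nat
    by (induction b) auto
  have "total_recursive (Suc (Suc n)) (\<lambda>ys. rec_nat 0 (\<lambda>k v. k) (ys ! 1))"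
    by (intro total_recursive_rec_nat total_recursive_nth total_recursive_const) auto
  then have "total_recursive n (\<lambda>xs. rec_nat (f xs) (\<lambda>k v. v - 1) (g xs))"
    unfolding pred by (intro total_recursive_rec_nat assms)
  then show ?thesis
    by (simp only: minus)
qed

section \<open>Decidable relations, bounded quantifiers and minimisation\<close>

definition decidable :: "nat \<Rightarrow> (nat list \<Rightarrow> bool) \<Rightarrow> bool" where
  "decidable n P \<longleftrightarrow> total_recursive n (\<lambda>xs. of_bool (P xs))"

lemma decidable_cong:
  assumes "decidable n P" "\<And>xs. length xs = n \<Longrightarrow> P' xs = P xs"
  shows "decidable n P'"
  using assms unfolding decidable_def by (auto elim!: total_recursive_cong)

lemma decidable_less:
  assumes "total_recursive n f" "total_recursive n g"
  shows "decidable n (\<lambda>xs. f xs < g xs)"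
proof -
  have "total_recursive n (\<lambda>xs. 1 - (1 - (g xs - f xs)))"
    by (intro total_recursive_diff total_recursive_const assms)
  moreover have "of_bool (a < b) = 1 - (1 - (b - a))" for a b :: nat
    by auto
  ultimately show ?thesis
    unfolding decidable_def by simp
qed

lemma decidable_not:
  assumes "decidable n P"
  shows "decidable n (\<lambda>xs. \<not> P xs)"
proof -
  have "total_recursive n (\<lambda>xs. 1 - of_bool (P xs))"
    using assms unfolding decidable_def by (intro total_recursive_diff total_recursive_const)
  then show ?thesis
    unfolding decidable_def by (rule total_recursive_cong) simp
qed

lemma decidable_conj:
  assumes "decidable n P" "decidable n Q"
  shows "decidable n (\<lambda>xs. P xs \<and> Q xs)"
  using total_recursive_mult assms unfolding decidable_def of_bool_conj by blast

text \<open>A bounded search succeeds iff the sum of the characteristic function over the range is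
  positive.\<close>

lemma decidable_bex:
  assumes b: "total_recursive n b" and P: "decidable (Suc n) (\<lambda>ys. P (ys ! 0) (tl ys))"
  shows "decidable n (\<lambda>xs. \<exists>i<b xs. P i xs)"
proof -
  have "total_recursive n (\<lambda>xs. \<Sum>i<b xs. of_bool (P i xs))"
    using P unfolding decidable_def by (rule total_recursive_sum[OF b])
  then have "decidable n (\<lambda>xs. 0 < (\<Sum>i<b xs. of_bool (P i xs) :: nat))"
    by (intro decidable_less total_recursive_const)
  moreover have "0 < (\<Sum>i<k. of_bool (P i xs) :: nat) \<longleftrightarrow> (\<exists>i<k. P i xs)" for k xs
    unfolding neq0_conv[symmetric] by (subst sum_eq_0_iff) auto
  ultimately show ?thesis
    by (simp only:)
qed

lemma decidable_ball:
  assumes b: "total_recursive n b" and P: "decidable (Suc n) (\<lambda>ys. P (ys ! 0) (tl ys))"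
  shows "decidable n (\<lambda>xs. \<forall>i<b xs. P i xs)"
  by (rule decidable_cong[OF decidable_not[OF decidable_bex[OF b decidable_not[OF P]]]]) blast

lemma decidable_eq:
  assumes "total_recursive n f" "total_recursive n g"
  shows "decidable n (\<lambda>xs. f xs = g xs)"
proof -
  have "decidable n (\<lambda>xs. \<not> f xs < g xs \<and> \<not> g xs < f xs)"
    by (intro decidable_conj decidable_not decidable_less assms)
  then show ?thesis
    by (rule decidable_cong) auto
qed

lemma total_recursive_if:
  assumes "decidable n P" "total_recursive n f" "total_recursive n g"
  shows "total_recursive n (\<lambda>xs. if P xs then f xs else g xs)"
proof -
  have "total_recursive n (\<lambda>xs. of_bool (P xs) * f xs + of_bool (\<not> P xs) * g xs)"
    using assms decidable_not[OF assms(1)] unfolding decidable_def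
    by (intro total_recursive_add total_recursive_mult)
  then show ?thesis
    by (rule total_recursive_cong) simp
qed

lemma total_recursive_Least:
  assumes P: "decidable (Suc n) (\<lambda>ys. P (ys ! 0) (tl ys))"
    and ex: "\<And>xs. length xs = n \<Longrightarrow> \<exists>z. P z xs"
  shows "total_recursive n (\<lambda>xs. LEAST z. P z xs)"
proof -
  \<comment> \<open>Minimisation looks for a zero, hence the characteristic function of the
    negation.\<close>
  obtain f where f: "recursive_fn (Suc n) f"
      "\<And>ys. length ys = Suc n \<Longrightarrow> of_bool (\<not> P (ys ! 0) (tl ys)) = f ys"
    using decidable_not[OF P] unfolding decidable_def total_recursive_def by blast
  have *: "f (z # xs) = 0 \<longleftrightarrow> P z xs" if "length xs = n" for z xs
    using f(2)[of "z # xs"] that by (auto split: if_splits)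
  have "recursive_fn n (\<lambda>xs. LEAST z. f (z # xs) = 0)"
    by (rule recursive_fn.minimise) (use f ex * in auto)
  then show ?thesis
    by (rule total_recursive_cong[OF recursive_fn_imp_total_recursive]) (simp add: *)
qed

lemmas total_recursive_intros =
  total_recursive_const total_recursive_nth total_recursive_nth_tl total_recursive_nth_tl_tl
  total_recursive_Suc total_recursive_add total_recursive_mult total_recursive_power
  total_recursive_diff total_recursive_sum total_recursive_prod total_recursive_if
  decidable_less decidable_eq decidable_not decidable_conj decidable_bex decidable_ball

section \<open>Computable rational functions\<close>

lemma computable_rat_fn_cong:
  assumes "computable_rat_fn n f" "\<And>xs. length xs = n \<Longrightarrow> f' xs = f xs"
  shows "computable_rat_fn n f'"
  using assms unfolding computable_rat_fn_def by metis

text \<open>Allows any positive denominator \<open>d\<close>; the successor form of the definition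
  is recovered with \<open>d xs - 1\<close>.\<close>

lemma computable_rat_fnI:
  assumes "total_recursive n a" "total_recursive n b" "total_recursive n d"
    and "\<And>xs. length xs = n \<Longrightarrow> 0 < d xs"
    and f: "\<And>xs. length xs = n \<Longrightarrow> f xs = (of_nat (a xs) - of_nat (b xs)) / of_nat (d xs)"
  shows "computable_rat_fn n f"
proof -
  have "total_recursive n (\<lambda>xs. d xs - 1)"
    by (intro total_recursive_intros assms)
  then obtain c where c: "recursive_fn n c" "\<And>xs. length xs = n \<Longrightarrow> d xs - 1 = c xs"
    unfolding total_recursive_def by blast
  obtain a' where a': "recursive_fn n a'" "\<And>xs. length xs = n \<Longrightarrow> a xs = a' xs"
    using assms unfolding total_recursive_def by blast
  obtain b' where b': "recursive_fn n b'" "\<And>xs. length xs = n \<Longrightarrow> b xs = b' xs"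
    using assms unfolding total_recursive_def by blast
  have "f xs = (of_nat (a' xs) - of_nat (b' xs)) / of_nat (Suc (c xs))" if "length xs = n" for xs
    using f[OF that] a'(2)[OF that] b'(2)[OF that] c(2)[OF that] assms(4)[OF that]
    by (metis Suc_pred' One_nat_def)
  then show ?thesis
    unfolding computable_rat_fn_def using a' b' c by blast
qed

lemma computable_rat_fnE:
  assumes "computable_rat_fn n f"
  obtains a b d where "total_recursive n a" "total_recursive n b" "total_recursive n d"
    and "\<And>xs. 0 < d xs"
    and "\<And>xs. length xs = n \<Longrightarrow> f xs = (of_nat (a xs) - of_nat (b xs)) / of_nat (d xs)"
proof -
  obtain a b c where "recursive_fn n a" "recursive_fn n b" "recursive_fn n c"
      "\<And>xs. length xs = n \<Longrightarrow> f xs = (of_nat (a xs) - of_nat (b xs)) / of_nat (Suc (c xs))"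
    using assms unfolding computable_rat_fn_def by blast
  then show thesis
    using that[of a b "\<lambda>xs. Suc (c xs)"]
    by (auto intro!: recursive_fn_imp_total_recursive total_recursive_Suc)
qed

lemma computable_rat_fn_subst1:
  assumes "computable_rat_fn 1 (\<lambda>xs. q (xs ! 0))" "total_recursive n g"
  shows "computable_rat_fn n (\<lambda>xs. q (g xs))"
proof -
  obtain a b d where abd: "total_recursive 1 a" "total_recursive 1 b" "total_recursive 1 d"
      "\<And>xs. 0 < d xs"
      "\<And>xs. length xs = 1 \<Longrightarrow> q (xs ! 0) = (of_nat (a xs) - of_nat (b xs)) / of_nat (d xs)"
    using computable_rat_fnE[OF assms(1)] by blast
  have "q i = (of_nat (a [i]) - of_nat (b [i])) / of_nat (d [i])" for i
    using abd(5)[of "[i]"] by simp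
  then show ?thesis
    using abd assms(2)
    by (intro computable_rat_fnI[of n "\<lambda>xs. a [g xs]" "\<lambda>xs. b [g xs]" "\<lambda>xs. d [g xs]"]
        total_recursive_subst1) auto
qed

lemma computable_rat_fn_subst2:
  assumes "computable_rat_fn 2 (\<lambda>xs. q (xs ! 0) (xs ! 1))"
    and "total_recursive n g" "total_recursive n h"
  shows "computable_rat_fn n (\<lambda>xs. q (g xs) (h xs))"
proof -
  obtain a b d where abd: "total_recursive 2 a" "total_recursive 2 b" "total_recursive 2 d"
      "\<And>xs. 0 < d xs"
      "\<And>xs. length xs = 2 \<Longrightarrow>
        q (xs ! 0) (xs ! 1) = (of_nat (a xs) - of_nat (b xs)) / of_nat (d xs)"
    using computable_rat_fnE[OF assms(1)] by blast
  have "q i j = (of_nat (a [i, j]) - of_nat (b [i, j])) / of_nat (d [i, j])" for i j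
    using abd(5)[of "[i, j]"] by simp
  then show ?thesis
    using abd assms(2,3)
    by (intro computable_rat_fnI[of n "\<lambda>xs. a [g xs, h xs]" "\<lambda>xs. b [g xs, h xs]"
          "\<lambda>xs. d [g xs, h xs]"] total_recursive_subst2) auto
qed

lemma computable_rat_fn_of_nat:
  assumes "total_recursive n f"
  shows "computable_rat_fn n (\<lambda>xs. of_nat (f xs))"
  by (rule computable_rat_fnI[OF assms, of "\<lambda>_. 0" "\<lambda>_. 1"])
    (auto intro: total_recursive_const)

lemma computable_rat_fn_of_bool:
  assumes "decidable n P"
  shows "computable_rat_fn n (\<lambda>xs. of_bool (P xs))"
  using computable_rat_fn_of_nat[of n "\<lambda>xs. of_bool (P xs)"] assms
  by (simp add: decidable_def)

lemma computable_rat_fn_inverse_of_nat: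
  assumes "total_recursive n f" "\<And>xs. length xs = n \<Longrightarrow> 0 < f xs"
  shows "computable_rat_fn n (\<lambda>xs. 1 / of_nat (f xs))"
  by (rule computable_rat_fnI[of n "\<lambda>_. 1" "\<lambda>_. 0" f])
    (use assms in \<open>auto intro: total_recursive_const\<close>)

lemma computable_rat_fn_inverse_power2:
  assumes "total_recursive n f"
  shows "computable_rat_fn n (\<lambda>xs. 1 / 2 ^ f xs)"
proof -
  have "computable_rat_fn n (\<lambda>xs. 1 / of_nat (2 ^ f xs))"
    by (intro computable_rat_fn_inverse_of_nat total_recursive_intros assms) simp
  then show ?thesis
    by simp
qed

section \<open>Arithmetic and finite sums of computable rational functions\<close>

lemma computable_rat_fn_add:
  assumes "computable_rat_fn n f" "computable_rat_fn n g"
  shows "computable_rat_fn n (\<lambda>xs. f xs + g xs)"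
proof -
  obtain a b d where f: "total_recursive n a" "total_recursive n b" "total_recursive n d"
      "\<And>xs. 0 < d xs"
      "\<And>xs. length xs = n \<Longrightarrow> f xs = (of_nat (a xs) - of_nat (b xs)) / of_nat (d xs)"
    using computable_rat_fnE[OF assms(1)] by blast
  obtain a' b' d' where g: "total_recursive n a'" "total_recursive n b'" "total_recursive n d'"
      "\<And>xs. 0 < d' xs"
      "\<And>xs. length xs = n \<Longrightarrow> g xs = (of_nat (a' xs) - of_nat (b' xs)) / of_nat (d' xs)"
    using computable_rat_fnE[OF assms(2)] by blast
  show ?thesis
  proof (rule computable_rat_fnI[of n "\<lambda>xs. a xs * d' xs + a' xs * d xs"
        "\<lambda>xs. b xs * d' xs + b' xs * d xs" "\<lambda>xs. d xs * d' xs"])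
    fix xs :: "nat list" assume "length xs = n"
    then show "f xs + g xs = (of_nat (a xs * d' xs + a' xs * d xs)
        - of_nat (b xs * d' xs + b' xs * d xs)) / of_nat (d xs * d' xs)"
      using f(4)[of xs] g(4)[of xs] by (simp add: f(5) g(5) field_simps)
  qed (use f g in \<open>auto intro!: total_recursive_intros\<close>)
qed

lemma computable_rat_fn_uminus:
  assumes "computable_rat_fn n f"
  shows "computable_rat_fn n (\<lambda>xs. - f xs)"
proof -
  obtain a b d where f: "total_recursive n a" "total_recursive n b" "total_recursive n d"
      "\<And>xs. 0 < d xs"
      "\<And>xs. length xs = n \<Longrightarrow> f xs = (of_nat (a xs) - of_nat (b xs)) / of_nat (d xs)"
    using computable_rat_fnE[OF assms(1)] by blast
  show ?thesis
    by (rule computable_rat_fnI[of n b a d]) (use f in \<open>auto simp: minus_divide_left\<close>)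
qed

lemma computable_rat_fn_diff:
  assumes "computable_rat_fn n f" "computable_rat_fn n g"
  shows "computable_rat_fn n (\<lambda>xs. f xs - g xs)"
  using computable_rat_fn_add[OF assms(1) computable_rat_fn_uminus[OF assms(2)]] by simp

lemma computable_rat_fn_mult:
  assumes "computable_rat_fn n f" "computable_rat_fn n g"
  shows "computable_rat_fn n (\<lambda>xs. f xs * g xs)"
proof -
  obtain a b d where f: "total_recursive n a" "total_recursive n b" "total_recursive n d"
      "\<And>xs. 0 < d xs"
      "\<And>xs. length xs = n \<Longrightarrow> f xs = (of_nat (a xs) - of_nat (b xs)) / of_nat (d xs)"
    using computable_rat_fnE[OF assms(1)] by blast
  obtain a' b' d' where g: "total_recursive n a'" "total_recursive n b'" "total_recursive n d'"
      "\<And>xs. 0 < d' xs"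
      "\<And>xs. length xs = n \<Longrightarrow> g xs = (of_nat (a' xs) - of_nat (b' xs)) / of_nat (d' xs)"
    using computable_rat_fnE[OF assms(2)] by blast
  show ?thesis
  proof (rule computable_rat_fnI[of n "\<lambda>xs. a xs * a' xs + b xs * b' xs"
        "\<lambda>xs. a xs * b' xs + b xs * a' xs" "\<lambda>xs. d xs * d' xs"])
    fix xs :: "nat list" assume "length xs = n"
    then show "f xs * g xs = (of_nat (a xs * a' xs + b xs * b' xs)
        - of_nat (a xs * b' xs + b xs * a' xs)) / of_nat (d xs * d' xs)"
      using f(4)[of xs] g(4)[of xs] by (simp add: f(5) g(5) field_simps)
  qed (use f g in \<open>auto intro!: total_recursive_intros\<close>)
qed

text \<open>Turns a sum of fractions into one fraction whose numerator and denominator are sums and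
  products of naturals, hence recursive. The product with the factor at \<open>i\<close> replaced by
  1 is the cofactor of \<open>d i\<close>, expressed without division.\<close>

lemma sum_divide_common_denominator:
  fixes a d :: "nat \<Rightarrow> nat"
  assumes "\<And>i. 0 < d i"
  shows "(\<Sum>i<k. of_nat (a i) / of_nat (d i) :: rat)
    = of_nat (\<Sum>i<k. a i * (\<Prod>j<k. if j = i then 1 else d j)) / of_nat (\<Prod>j<k. d j)"
proof -
  have "(of_nat (a i) / of_nat (d i) :: rat)
      = of_nat (a i * (\<Prod>j<k. if j = i then 1 else d j)) / of_nat (\<Prod>j<k. d j)"
    if "i < k" for i
  proof -
    have "(\<Prod>j<k. d j) = d i * prod d ({..<k} - {i})"
      using that by (intro prod.remove) auto
    moreover have "(\<Prod>j<k. if j = i then 1 else d j) = prod d ({..<k} - {i})"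
      using that by (subst prod.remove[of _ i]) auto
    moreover have "prod d ({..<k} - {i}) > 0"
      using assms by (simp add: prod_pos)
    ultimately show ?thesis
      using assms[of i] by simp
  qed
  then show ?thesis
    unfolding of_nat_sum sum_divide_distrib by (intro sum.cong) auto
qed

lemma computable_rat_fn_sum:
  assumes b: "total_recursive n B"
    and F: "computable_rat_fn (Suc n) (\<lambda>ys. F (ys ! 0) (tl ys))"
  shows "computable_rat_fn n (\<lambda>xs. \<Sum>i<B xs. F i xs)"
proof -
  obtain a b d where abd: "total_recursive (Suc n) a" "total_recursive (Suc n) b"
      "total_recursive (Suc n) d" "\<And>xs. 0 < d xs"
      "\<And>xs. length xs = Suc n \<Longrightarrow>
        F (xs ! 0) (tl xs) = (of_nat (a xs) - of_nat (b xs)) / of_nat (d xs)"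
    using computable_rat_fnE[OF F] by blast
  let ?D = "\<lambda>i xs. \<Prod>j<B xs. if j = i then 1 else d (j # xs)"
  have F_eq: "F i xs = of_nat (a (i # xs)) / of_nat (d (i # xs)) - of_nat (b (i # xs)) / of_nat (d (i # xs))"
    if "length xs = n" for i xs
    using abd(5)[of "i # xs"] that by (simp add: diff_divide_distrib)
  have arg_cons: "total_recursive (Suc n) (\<lambda>ys. f (ys ! 0 # tl ys))"
    if "total_recursive (Suc n) f" for f
    using total_recursive_Cons_tl[OF that total_recursive_nth[of 0]] by simp
  have "total_recursive (Suc (Suc n)) (\<lambda>ys. d (ys ! 0 # tl (tl ys)))"
    using total_recursive_Cons_tl_tl[OF abd(3) total_recursive_nth[of 0]] by simp
  then have "total_recursive (Suc n) (\<lambda>ys. ?D (ys ! 0) (tl ys))"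
    by (intro total_recursive_intros total_recursive_tl b) simp_all
  then have weighted_sum: "total_recursive n (\<lambda>xs. \<Sum>i<B xs. f (i # xs) * ?D i xs)"
    if "total_recursive (Suc n) f" for f
    by (intro total_recursive_sum total_recursive_mult b arg_cons that)
  show ?thesis
  proof (rule computable_rat_fnI[of n "\<lambda>xs. \<Sum>i<B xs. a (i # xs) * ?D i xs"
        "\<lambda>xs. \<Sum>i<B xs. b (i # xs) * ?D i xs" "\<lambda>xs. \<Prod>i<B xs. d (i # xs)"])
    fix xs :: "nat list" assume xs: "length xs = n"
    show "(\<Sum>i<B xs. F i xs) = (of_nat (\<Sum>i<B xs. a (i # xs) * ?D i xs)
        - of_nat (\<Sum>i<B xs. b (i # xs) * ?D i xs)) / of_nat (\<Prod>i<B xs. d (i # xs))"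
      unfolding F_eq[OF xs] sum_subtractf diff_divide_distrib
      using sum_divide_common_denominator[of "\<lambda>i. d (i # xs)"] abd(4) by simp
  next
    show "0 < (\<Prod>i<B xs. d (i # xs))" for xs
      using abd(4) by (simp add: prod_pos)
  next
    show "total_recursive n (\<lambda>xs. \<Prod>i<B xs. d (i # xs))"
      by (rule total_recursive_prod[OF b arg_cons[OF abd(3)]])
  qed (rule weighted_sum[OF abd(1)] weighted_sum[OF abd(2)])+
qed

section \<open>Comparisons and maxima of computable rational functions\<close>

lemma decidable_rat_less:
  assumes "computable_rat_fn n f" "computable_rat_fn n g"
  shows "decidable n (\<lambda>xs. f xs < g xs)"
proof -
  obtain a b d where h: "total_recursive n a" "total_recursive n b" "total_recursive n d"
      "\<And>xs. 0 < d xs"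
      "\<And>xs. length xs = n \<Longrightarrow> g xs - f xs = (of_nat (a xs) - of_nat (b xs)) / of_nat (d xs)"
    using computable_rat_fnE[OF computable_rat_fn_diff[OF assms(2,1)]] by blast
  \<comment> \<open>The denominator of the difference is positive, so its sign can be read off the
    two naturals in the numerator.\<close>
  have "decidable n (\<lambda>xs. b xs < a xs)"
    by (intro decidable_less h(1,2))
  then show ?thesis
  proof (rule decidable_cong)
    fix xs :: "nat list" assume xs: "length xs = n"
    have "f xs < g xs \<longleftrightarrow> 0 < g xs - f xs"
      by simp
    also have "\<dots> \<longleftrightarrow> b xs < a xs"
      using h(4)[of xs] unfolding h(5)[OF xs] by (simp add: zero_less_divide_iff)
    finally show "f xs < g xs \<longleftrightarrow> b xs < a xs" .
  qed
qed

lemma decidable_rat_le: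
  assumes "computable_rat_fn n f" "computable_rat_fn n g"
  shows "decidable n (\<lambda>xs. f xs \<le> g xs)"
  by (rule decidable_cong[OF decidable_not[OF decidable_rat_less[OF assms(2,1)]]]) auto

lemma computable_rat_fn_max:
  assumes "computable_rat_fn n f" "computable_rat_fn n g"
  shows "computable_rat_fn n (\<lambda>xs. max (f xs) (g xs))"
proof -
  have "computable_rat_fn n (\<lambda>xs. f xs + of_bool (f xs < g xs) * (g xs - f xs))"
    by (intro computable_rat_fn_add computable_rat_fn_mult computable_rat_fn_diff
        computable_rat_fn_of_bool decidable_rat_less assms)
  then show ?thesis
    by (rule computable_rat_fn_cong) auto
qed

lemmas computable_rat_fn_intros =
  computable_rat_fn_of_nat computable_rat_fn_of_bool computable_rat_fn_inverse_power2
  computable_rat_fn_add computable_rat_fn_diff computable_rat_fn_mult computable_rat_fn_sum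
  computable_rat_fn_max decidable_rat_less decidable_rat_le

lemma computable_rat_fn_Cons:
  assumes "computable_rat_fn (Suc n) f" "total_recursive n g"
  shows "computable_rat_fn n (\<lambda>xs. f (g xs # xs))"
proof -
  obtain a b d where f: "total_recursive (Suc n) a" "total_recursive (Suc n) b"
      "total_recursive (Suc n) d" "\<And>xs. 0 < d xs"
      "\<And>xs. length xs = Suc n \<Longrightarrow> f xs = (of_nat (a xs) - of_nat (b xs)) / of_nat (d xs)"
    using computable_rat_fnE[OF assms(1)] by blast
  note cons = total_recursive_Cons[OF _ assms(2)]
  show ?thesis
    by (rule computable_rat_fnI[OF cons[OF f(1)] cons[OF f(2)] cons[OF f(3)]]) (use f(4,5) in auto)
qed

lemma computable_rat_fn_Cons_tl_tl:
  assumes "computable_rat_fn (Suc n) f" "total_recursive (Suc (Suc n)) g"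
  shows "computable_rat_fn (Suc (Suc n)) (\<lambda>xs. f (g xs # tl (tl xs)))"
proof -
  obtain a b d where f: "total_recursive (Suc n) a" "total_recursive (Suc n) b"
      "total_recursive (Suc n) d" "\<And>xs. 0 < d xs"
      "\<And>xs. length xs = Suc n \<Longrightarrow> f xs = (of_nat (a xs) - of_nat (b xs)) / of_nat (d xs)"
    using computable_rat_fnE[OF assms(1)] by blast
  note cons = total_recursive_Cons_tl_tl[OF _ assms(2)]
  show ?thesis
    by (rule computable_rat_fnI[OF cons[OF f(1)] cons[OF f(2)] cons[OF f(3)]]) (use f(4,5) in auto)
qed

lemma computable_rat_fn_Max:
  assumes B: "total_recursive n B"
    and F: "computable_rat_fn (Suc n) (\<lambda>ys. F (ys ! 0) (tl ys))"
  shows "computable_rat_fn n (\<lambda>xs. Max ((\<lambda>i. F i xs) ` {..B xs}))"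
proof -
  text \<open>
    The position of the maximum is found by minimisation, as primitive recursion is available
    for natural values only.
  \<close>
  let ?P = "\<lambda>j xs. \<forall>i<Suc (B xs). F i xs \<le> F j xs"
  have argmax: "\<exists>j\<le>B xs. ?P j xs" for xs
  proof -
    have "Max ((\<lambda>i. F i xs) ` {..B xs}) \<in> (\<lambda>i. F i xs) ` {..B xs}"
      by (rule Max_in) auto
    then obtain j where j: "j \<le> B xs" "Max ((\<lambda>i. F i xs) ` {..B xs}) = F j xs"
      by (metis (no_types, lifting) atMost_iff imageE)
    have "F i xs \<le> F j xs" if "i < Suc (B xs)" for i
      unfolding j(2)[symmetric] using that by (intro Max_ge) auto
    then show ?thesis
      using j(1) by auto
  qed
  have "computable_rat_fn (Suc (Suc n)) (\<lambda>zs. F (zs ! 0) (tl (tl zs)))"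
    using computable_rat_fn_Cons_tl_tl[OF F total_recursive_nth[of 0]] by simp
  moreover have "computable_rat_fn (Suc (Suc n)) (\<lambda>zs. F (tl zs ! 0) (tl (tl zs)))"
    using computable_rat_fn_Cons_tl_tl[OF F total_recursive_nth_tl[of 0]] by simp
  ultimately have "decidable (Suc n) (\<lambda>ys. ?P (ys ! 0) (tl ys))"
    by (intro decidable_ball decidable_rat_le total_recursive_intros total_recursive_tl B)
  then have J: "total_recursive n (\<lambda>xs. LEAST j. ?P j xs)"
    using argmax by (intro total_recursive_Least) meson+
  have "computable_rat_fn n (\<lambda>xs. F (LEAST j. ?P j xs) xs)"
    using computable_rat_fn_Cons[OF F J] by simp
  then show ?thesis
  proof (rule computable_rat_fn_cong)
    fix xs :: "nat list"
    obtain j where j: "j \<le> B xs" "?P j xs"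
      using argmax by blast
    have "(LEAST j. ?P j xs) \<le> B xs"
      using Least_le[of "\<lambda>j. ?P j xs", OF j(2)] j(1) by (rule le_trans)
    then show "Max ((\<lambda>i. F i xs) ` {..B xs}) = F (LEAST j. ?P j xs) xs"
      using LeastI[of "\<lambda>j. ?P j xs", OF j(2)] by (intro Max_eqI) auto
  qed
qed

lemma computable_rat_fn_partial_sum:
  assumes "computable_rat_seq r" "total_recursive n g"
  shows "computable_rat_fn n (\<lambda>xs. \<Sum>j<g xs. r j)"
  by (intro computable_rat_fn_sum computable_rat_fn_subst1[OF assms(1)[unfolded computable_rat_seq_def]]
      total_recursive_nth assms(2)) simp

section \<open>Semimeasures\<close>

text \<open>The bound on finite sums at each stage bounds every \<open>q i\<close>, which therefore
  converges, and it survives the passage to the limit. Constructing a semimeasure is thus reduced to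
  finite rational estimates.\<close>

lemma lsc_semimeasure_of_approximation:
  fixes q :: "nat \<Rightarrow> nat \<Rightarrow> rat"
  assumes q: "computable_rat_seq2 q" and inc: "\<And>i. incseq (q i)"
    and nonneg: "\<And>i t. 0 \<le> q i t" and le1: "\<And>L t. (\<Sum>i<L. q i t) \<le> 1"
  obtains \<mu> where "lsc_semimeasure \<mu>" "\<And>i t. real_of_rat (q i t) \<le> \<mu> i"
proof -
  have q_le_1: "q i t \<le> 1" for i t
  proof -
    have "q i t \<le> (\<Sum>j<Suc i. q j t)"
      by (rule member_le_sum) (auto simp: nonneg)
    then show ?thesis
      using le1[where L = "Suc i" and t = t] by simp
  qed
  have "\<exists>l. (\<lambda>t. real_of_rat (q i t)) \<longlonglongrightarrow> l \<and> (\<forall>t. real_of_rat (q i t) \<le> l)" for i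
  proof -
    have "incseq (\<lambda>t. real_of_rat (q i t))" "\<forall>t. real_of_rat (q i t) \<le> 1"
      using inc[of i] q_le_1 by (auto simp: incseq_def of_rat_less_eq)
    then show ?thesis
      by (meson incseq_convergent)
  qed
  then obtain \<mu> where lim: "\<And>i. (\<lambda>t. real_of_rat (q i t)) \<longlonglongrightarrow> \<mu> i"
    and le: "\<And>i t. real_of_rat (q i t) \<le> \<mu> i"
    by metis
  have \<mu>_nonneg: "0 \<le> \<mu> i" for i
    using le[of i 0] nonneg[of i 0] by (meson order_trans zero_le_of_rat_iff)
  have partial: "(\<Sum>i<L. \<mu> i) \<le> 1" for L
  proof (rule LIMSEQ_le_const2)
    show "(\<lambda>t. \<Sum>i<L. real_of_rat (q i t)) \<longlonglongrightarrow> (\<Sum>i<L. \<mu> i)"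
      by (intro tendsto_sum lim)
    have "(\<Sum>i<L. real_of_rat (q i t)) \<le> 1" for t
      using le1[where L = L and t = t] by (metis of_rat_1 of_rat_less_eq of_rat_sum)
    then show "\<exists>N. \<forall>t\<ge>N. (\<Sum>i<L. real_of_rat (q i t)) \<le> 1"
      by blast
  qed
  have "summable \<mu>"
    by (rule summableI_nonneg_bounded[OF \<mu>_nonneg partial])
  then have "lsc_semimeasure \<mu>"
    unfolding lsc_semimeasure_def lower_semicomputable_def
    using \<mu>_nonneg q inc lim partial by (auto intro: suminf_le_const)
  then show thesis
    using le that by blast
qed

text \<open>Up to a factor, \<open>m\<close> dominates the semimeasure obtained from the weights
  \<open>1 / 2 ^ Suc i\<close>, which excludes \<open>m i = 0\<close>. This permits division by
  \<open>m i\<close>.\<close>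

lemma universal_semimeasure_pos:
  assumes m: "universal_semimeasure m"
  shows "0 < m i"
proof -
  have "computable_rat_seq2 (\<lambda>i t. 1 / 2 ^ Suc i)"
    unfolding computable_rat_seq2_def
    by (intro computable_rat_fn_inverse_power2 total_recursive_intros) simp
  moreover have "(\<Sum>i<L. 1 / 2 ^ Suc i :: rat) = 1 - 1 / 2 ^ L" for L
    by (induction L) (auto simp: field_simps)
  ultimately obtain \<mu> where \<mu>: "lsc_semimeasure \<mu>" "\<And>i. real_of_rat (1 / 2 ^ Suc i) \<le> \<mu> i"
    using lsc_semimeasure_of_approximation[of "\<lambda>i t. 1 / 2 ^ Suc i"] by (simp add: incseq_def) blast
  obtain c where "\<And>i. \<mu> i \<le> c * m i"
    using m \<mu>(1) unfolding universal_semimeasure_def by blast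
  moreover have "0 < real_of_rat (1 / 2 ^ Suc i)"
    by simp
  ultimately have "0 < c * m i"
    using \<mu>(2)[of i] by (meson less_le_trans)
  moreover have "0 \<le> m i"
    using m unfolding universal_semimeasure_def lsc_semimeasure_def by blast
  ultimately show ?thesis
    by (cases "m i = 0") auto
qed

text \<open>By monotonicity the gaps are pairwise disjoint, so their lengths add up to the measure
  of a subset of \<open>U\<close>.\<close>

lemma sum_consecutive_gaps_le_emeasure:
  fixes s :: "nat \<Rightarrow> real"
  assumes s: "incseq s" and fin: "finite A" and U: "U \<in> sets lborel"
    and sub: "\<And>i. i \<in> A \<Longrightarrow> {s i<..<s (Suc i)} \<subseteq> U"
    and meas: "emeasure lborel U \<le> ennreal c" and c: "0 \<le> c"
  shows "(\<Sum>i\<in>A. s (Suc i) - s i) \<le> c"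
proof -
  have gap: "0 \<le> s (Suc i) - s i" for i
    using s by (simp add: incseq_SucD)
  have "{s i<..<s (Suc i)} \<inter> {s j<..<s (Suc j)} = {}" if "i < j" for i j
    using incseqD[OF s, of "Suc i" j] that by auto
  then have "disjoint_family_on (\<lambda>i. {s i<..<s (Suc i)}) A"
    unfolding disjoint_family_on_def by (metis Int_commute linorder_neqE_nat)
  then have "(\<Sum>i\<in>A. emeasure lborel {s i<..<s (Suc i)})
      = emeasure lborel (\<Union>i\<in>A. {s i<..<s (Suc i)})"
    using fin by (intro sum_emeasure) auto
  also have "\<dots> \<le> emeasure lborel U"
    using sub U by (intro emeasure_mono) auto
  also have "\<dots> \<le> ennreal c"
    by (rule meas)
  finally have "ennreal (\<Sum>i\<in>A. s (Suc i) - s i) \<le> ennreal c"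
    using gap by (simp add: sum_ennreal)
  then show ?thesis
    using c by simp
qed

section \<open>Randomness\<close>

lemma eventually_less_universal_if_in_test:
  fixes r :: "nat \<Rightarrow> rat"
  assumes m: "universal_semimeasure m" and r: "computable_rat_seq r" and pos: "\<And>i. 0 < r i"
    and sums: "(\<lambda>i. real_of_rat (r i)) sums \<alpha>"
    and test: "martin_loef_test U" and \<alpha>: "\<alpha> \<in> (\<Inter>n. U n)" and \<epsilon>: "0 < \<epsilon>"
  shows "\<forall>\<^sub>F i in sequentially. real_of_rat (r i) < \<epsilon> * m i"
proof -
  obtain a b where a: "computable_rat_seq2 a" and b: "computable_rat_seq2 b"
    and U: "\<And>n. U n = (\<Union>k. {real_of_rat (a n k) <..< real_of_rat (b n k)})"
    using test unfolding martin_loef_test_def uniformly_effectively_open_def by blast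
  have meas: "emeasure lborel (U n) \<le> ennreal (1 / 2 ^ n)" for n
    using test unfolding martin_loef_test_def by blast
  define s where "s i = (\<Sum>j<i. r j)" for i
  have s_lim: "(\<lambda>i. real_of_rat (s i)) \<longlonglongrightarrow> \<alpha>"
    using sums unfolding sums_def s_def by (simp add: of_rat_sum)
  have s_inc: "incseq (\<lambda>i. real_of_rat (s i))"
    using pos by (intro incseq_SucI) (simp add: s_def of_rat_less_eq less_imp_le)
  have s_less: "real_of_rat (s i) < \<alpha>" for i
  proof -
    have "real_of_rat (s i) < real_of_rat (s (Suc i))"
      using pos by (simp add: s_def of_rat_less)
    then show ?thesis
      using incseq_le[OF s_inc s_lim, of "Suc i"] by simp
  qed
  \<comment> \<open>At stage \<open>t\<close> only the first \<open>t\<close> intervals are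
    inspected, which makes \<open>hit\<close> decidable and monotone in \<open>t\<close>. A gap met
    by several intervals still counts once.\<close>
  define hit where "hit n t i \<longleftrightarrow> (\<exists>k<t. a n k < s i \<and> s (Suc i) < b n k)" for n t i
  have hit_mono: "hit n t i" if "hit n t' i" "t' \<le> t" for n t t' i
    using that unfolding hit_def by (meson less_le_trans)
  text \<open>
    The weights \<open>2 ^ n\<close> are paired with \<open>U (2 n + 1)\<close>, whose measure is at most
    \<open>2 ^ - (2 n + 1)\<close>, so that the total mass is at most the sum of all \<open>2 ^ - (n + 1)\<close>.
  \<close>
  define q where "q i t = (\<Sum>n<t. of_nat (2 ^ n) * (of_bool (hit (2 * n + 1) t i) * r i))" for i t
  have "computable_rat_fn 2
    (\<lambda>xs. \<Sum>n<xs ! 1. of_nat (2 ^ n) * (of_bool (hit (2 * n + 1) (xs ! 1) (xs ! 0)) * r (xs ! 0)))"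
    unfolding hit_def s_def
    by (intro computable_rat_fn_intros decidable_bex decidable_conj
        computable_rat_fn_subst2[OF a[unfolded computable_rat_seq2_def]]
        computable_rat_fn_subst2[OF b[unfolded computable_rat_seq2_def]]
        computable_rat_fn_subst1[OF r[unfolded computable_rat_seq_def]]
        computable_rat_fn_partial_sum[OF r] total_recursive_intros) simp_all
  then have q: "computable_rat_seq2 q"
    unfolding computable_rat_seq2_def q_def .
  have term_nonneg: "0 \<le> of_nat (2 ^ n) * (of_bool (hit (2 * n + 1) t i) * r i)" for n t i
    using pos[of i] by simp
  have q_nonneg: "0 \<le> q i t" for i t
    unfolding q_def by (intro sum_nonneg term_nonneg)
  have q_inc: "incseq (q i)" for i
  proof (rule incseq_SucI)
    fix t
    \<comment> \<open>From one stage to the next, first the hits increase, then a nonnegative term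
      for \<open>n = t\<close> is added.\<close>
    have "q i t \<le> (\<Sum>n<t. of_nat (2 ^ n) * (of_bool (hit (2 * n + 1) (Suc t) i) * r i))"
      unfolding q_def using pos[of i] hit_mono[of _ t i "Suc t"]
      by (intro sum_mono mult_left_mono mult_right_mono) (auto simp: less_imp_le)
    also have "\<dots> \<le> q i (Suc t)"
      unfolding q_def using term_nonneg[of t "Suc t" i] by simp
    finally show "q i t \<le> q i (Suc t)" .
  qed
  have hit_sum: "(\<Sum>i<L. of_bool (hit n t i) * r i) \<le> 1 / 2 ^ n" for L n t
  proof -
    have "{real_of_rat (s i)<..<real_of_rat (s (Suc i))} \<subseteq> U n" if hit: "hit n t i" for i
    proof -
      obtain k where "a n k < s i" "s (Suc i) < b n k"
        using hit unfolding hit_def by blast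
      then have "real_of_rat (a n k) < real_of_rat (s i)"
          "real_of_rat (s (Suc i)) < real_of_rat (b n k)"
        by (simp_all add: of_rat_less)
      then have "{real_of_rat (s i)<..<real_of_rat (s (Suc i))}
          \<subseteq> {real_of_rat (a n k)<..<real_of_rat (b n k)}"
        by auto
      then show ?thesis
        unfolding U by blast
    qed
    then have "(\<Sum>i\<in>{i. i < L \<and> hit n t i}. real_of_rat (s (Suc i)) - real_of_rat (s i)) \<le> 1 / 2 ^ n"
      using meas by (intro sum_consecutive_gaps_le_emeasure[OF s_inc, of _ "U n"]) (auto simp: U)
    also have "(\<Sum>i\<in>{i. i < L \<and> hit n t i}. real_of_rat (s (Suc i)) - real_of_rat (s i))
        = (\<Sum>i<L. of_bool (hit n t i) * real_of_rat (r i))"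
      by (intro sum.mono_neutral_cong_left) (auto simp: s_def of_rat_add)
    also have "\<dots> = real_of_rat (\<Sum>i<L. of_bool (hit n t i) * r i)"
      by (simp add: of_rat_sum of_rat_mult)
    also have "(1 / 2 ^ n :: real) = real_of_rat (1 / 2 ^ n)"
      by (simp add: of_rat_divide of_rat_power)
    finally show ?thesis
      by (simp only: of_rat_less_eq)
  qed
  have "(\<Sum>i<L. q i t) \<le> 1" for L t
  proof -
    \<comment> \<open>Summing over the gaps first allows the measure bound to be applied separately
      for each \<open>n\<close>.\<close>
    have "(\<Sum>i<L. q i t) = (\<Sum>n<t. of_nat (2 ^ n) * (\<Sum>i<L. of_bool (hit (2 * n + 1) t i) * r i))"
      unfolding q_def sum_distrib_left by (rule sum.swap)
    also have "\<dots> \<le> (\<Sum>n<t. of_nat (2 ^ n) * (1 / 2 ^ (2 * n + 1)))"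
      by (intro sum_mono mult_left_mono hit_sum) auto
    also have "\<dots> = (\<Sum>n<t. 1 / 2 ^ Suc n)"
    proof (intro sum.cong refl)
      fix n :: nat
      have "2 * n + 1 = n + Suc n"
        by simp
      then show "of_nat (2 ^ n) * (1 / 2 ^ (2 * n + 1)) = (1 / 2 ^ Suc n :: rat)"
        by (simp only: power_add) simp
    qed
    also have "\<dots> = 1 - 1 / 2 ^ t"
      by (induction t) (auto simp: field_simps)
    finally show ?thesis
      by (rule order_trans) simp
  qed
  then obtain \<mu> where \<mu>: "lsc_semimeasure \<mu>" "\<And>i t. real_of_rat (q i t) \<le> \<mu> i"
    using lsc_semimeasure_of_approximation[OF q q_inc q_nonneg] by blast
  \<comment> \<open>The factor \<open>c\<close> is fixed before \<open>n\<close> is chosen, so the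
    weight \<open>2 ^ n\<close> can be made to outgrow \<open>c / \<epsilon>\<close>.\<close>
  obtain c where c: "\<And>i. \<mu> i \<le> c * m i"
    using m \<mu>(1) unfolding universal_semimeasure_def by blast
  obtain n where n: "c / \<epsilon> < 2 ^ n"
    using real_arch_pow[of 2 "c / \<epsilon>"] by auto
  \<comment> \<open>A single interval around \<open>\<alpha>\<close> contains almost all gaps, since
    the partial sums converge to \<open>\<alpha>\<close> from below.\<close>
  obtain k where k: "real_of_rat (a (2 * n + 1) k) < \<alpha>" "\<alpha> < real_of_rat (b (2 * n + 1) k)"
    using \<alpha> U by fastforce
  have "\<forall>\<^sub>F i in sequentially. real_of_rat (a (2 * n + 1) k) < real_of_rat (s i)"
    using order_tendstoD(1)[OF s_lim k(1)] .
  then show ?thesis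
  proof (rule eventually_mono)
    fix i assume "real_of_rat (a (2 * n + 1) k) < real_of_rat (s i)"
    moreover have "real_of_rat (s (Suc i)) < real_of_rat (b (2 * n + 1) k)"
      using s_less k(2) by (rule less_trans)
    ultimately have "hit (2 * n + 1) (Suc k) i"
      unfolding hit_def by (auto simp: of_rat_less)
    \<comment> \<open>A stage above both indices: \<open>k\<close> is then among the inspected
      intervals and \<open>n\<close> in the range of the sum \<open>q\<close>.\<close>
    then have "hit (2 * n + 1) (Suc (n + k)) i"
      by (rule hit_mono) simp
    then have "of_nat (2 ^ n) * r i
        = of_nat (2 ^ n) * (of_bool (hit (2 * n + 1) (Suc (n + k)) i) * r i)"
      by simp
    also have "\<dots> \<le> q i (Suc (n + k))"
      unfolding q_def by (rule member_le_sum) (use term_nonneg in auto)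
    finally have "real_of_rat (of_nat (2 ^ n) * r i) \<le> \<mu> i"
      using \<mu>(2) by (meson of_rat_less_eq order_trans)
    then have "2 ^ n * real_of_rat (r i) \<le> c * m i"
      using c[of i] by (simp add: of_rat_mult of_rat_power)
    also have "\<dots> < 2 ^ n * (\<epsilon> * m i)"
      using n \<epsilon> universal_semimeasure_pos[OF m, of i] by (simp add: field_simps)
    finally show "real_of_rat (r i) < \<epsilon> * m i"
      by simp
  qed
qed

section \<open>Small terms yield a test that captures the sum\<close>

lemma emeasure_UN_intervals_le:
  fixes a b :: "nat \<Rightarrow> real"
  assumes ab: "\<And>k. a k \<le> b k" and sum_le: "\<And>K. (\<Sum>k<K. b k - a k) \<le> c"
  shows "emeasure lborel (\<Union>k. {a k<..<b k}) \<le> ennreal c"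
proof -
  have "emeasure lborel (\<Union>k. {a k<..<b k}) \<le> (\<Sum>k. emeasure lborel {a k<..<b k})"
    by (intro emeasure_subadditive_countably) auto
  also have "\<dots> = (\<Sum>k. ennreal (b k - a k))"
    using ab by simp
  \<comment> \<open>As a supremum of finite sums, the series inherits any bound that is uniform in
    \<open>K\<close>.\<close>
  also have "\<dots> = (SUP K. \<Sum>k<K. ennreal (b k - a k))"
    by (rule suminf_eq_SUP)
  also have "\<dots> \<le> ennreal c"
  proof (rule SUP_least)
    fix K
    have "(\<Sum>k<K. ennreal (b k - a k)) = ennreal (\<Sum>k<K. b k - a k)"
      using ab by (intro sum_ennreal) simp
    then show "(\<Sum>k<K. ennreal (b k - a k)) \<le> ennreal c"
      using sum_le[of K] by (simp add: ennreal_leI)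
  qed
  finally show ?thesis .
qed

text \<open>
  The closed form of the frontier \<open>x t\<close> solves \<open>x (t + 1) = max (x t + e * (W (t + 1) - W t)) (s (t + 1))\<close>.
  It cannot pass \<open>\<alpha>\<close> by jumping to some \<open>s (t + 1)\<close>, as \<open>s\<close> stays below \<open>\<alpha>\<close>.
\<close>

lemma frontier_crossing:
  fixes s W x :: "nat \<Rightarrow> rat" and e :: rat and \<alpha> :: real
  assumes x: "\<And>t. x t = Max ((\<lambda>j. s j + e * (W t - W j)) ` {..t})"
    and s_le: "\<And>j. real_of_rat (s j) \<le> \<alpha>"
    and "T \<le> t" and T: "\<alpha> < real_of_rat (s T + e * (W t - W T))"
  shows "\<exists>t. real_of_rat (x t) \<le> \<alpha> \<and> \<alpha> < real_of_rat (x t + e * (W (Suc t) - W t))"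
proof -
  have x_ge: "s j + e * (W t - W j) \<le> x t" if "j \<le> t" for j t
    unfolding x using that by (intro Max_ge) auto
  have "\<alpha> < real_of_rat (x t)"
    using T x_ge[OF \<open>T \<le> t\<close>] by (meson less_le_trans of_rat_less_eq)
  \<comment> \<open>The first time at which the frontier is beyond \<open>\<alpha>\<close>. It is
    not 0, because \<open>x 0 = s 0\<close>.\<close>
  define u where "u = (LEAST t. \<alpha> < real_of_rat (x t))"
  have u: "\<alpha> < real_of_rat (x u)"
    unfolding u_def by (rule LeastI) fact
  moreover have "\<not> \<alpha> < real_of_rat (x 0)"
    using s_le[of 0] unfolding x by simp
  ultimately obtain v where v: "u = Suc v"
    by (cases u) auto
  have v_le: "real_of_rat (x v) \<le> \<alpha>"
    using not_less_Least[of v "\<lambda>t. \<alpha> < real_of_rat (x t)"] v unfolding u_def by simp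
  have "x u \<in> (\<lambda>j. s j + e * (W u - W j)) ` {..u}"
    unfolding x by (intro Max_in) auto
  then obtain j where j: "j \<le> u" "x u = s j + e * (W u - W j)"
    by blast
  \<comment> \<open>For \<open>j = u\<close> the value is \<open>s u\<close>, which is at most
    \<open>\<alpha>\<close>. So the maximum comes from an earlier \<open>j\<close>, and the crossing
    is due to an advance from \<open>x v\<close>.\<close>
  have "j \<noteq> u"
    using u s_le[of j] unfolding j(2) by auto
  then have "s j + e * (W v - W j) \<le> x v"
    using j(1) v by (intro x_ge) simp
  then have "x u \<le> x v + e * (W (Suc v) - W v)"
    unfolding j(2) by (simp add: v algebra_simps)
  then have "\<alpha> < real_of_rat (x v + e * (W (Suc v) - W v))"
    using u by (meson less_le_trans of_rat_less_eq)
  then show ?thesis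
    using v_le by blast
qed

text \<open>The advances of the frontier are the intervals of a test. Each level \<open>n\<close>
  has its own step factor \<open>e n\<close>, and \<open>frontier_crossing\<close> shows that some
  advance at that level covers \<open>\<alpha>\<close>.\<close>

lemma not_random_if_not_slow:
  fixes r :: "nat \<Rightarrow> rat"
  assumes m: "lsc_semimeasure m" and r: "computable_rat_seq r" and pos: "\<And>i. 0 < r i"
    and sums: "(\<lambda>i. real_of_rat (r i)) sums \<alpha>"
    and small: "\<And>\<epsilon>. 0 < \<epsilon> \<Longrightarrow> \<forall>\<^sub>F i in sequentially. real_of_rat (r i) < \<epsilon> * m i"
  shows "\<not> martin_loef_random \<alpha>"
proof -
  have m_nonneg: "0 \<le> m i" for i
    using m unfolding lsc_semimeasure_def by blast
  have m_summable: "summable m" and m_le1: "(\<Sum>i. m i) \<le> 1"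
    using m unfolding lsc_semimeasure_def by blast+
  obtain p where p: "computable_rat_seq2 p" and p_inc: "\<And>i. incseq (p i)"
    and p_lim: "\<And>i. (\<lambda>t. real_of_rat (p i t)) \<longlonglongrightarrow> m i"
    using m unfolding lsc_semimeasure_def lower_semicomputable_def by blast
  define s where "s i = (\<Sum>j<i. r j)" for i
  have s_lim: "(\<lambda>i. real_of_rat (s i)) \<longlonglongrightarrow> \<alpha>"
    using sums unfolding sums_def s_def by (simp add: of_rat_sum)
  have "incseq (\<lambda>i. real_of_rat (s i))"
    using pos by (intro incseq_SucI) (simp add: s_def of_rat_less_eq less_imp_le)
  then have s_le: "real_of_rat (s i) \<le> \<alpha>" for i
    using s_lim by (rule incseq_le)
  \<comment> \<open>The given approximations may be negative. Truncation at 0 keeps their limit,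
    since \<open>m i\<close> is nonnegative, and makes the partial masses monotone.\<close>
  define q where "q i t = max 0 (p i t)" for i t
  have q_nonneg: "0 \<le> q i t" for i t
    by (simp add: q_def)
  have q_mono: "q i t \<le> q i t'" if "t \<le> t'" for i t t'
    using incseqD[OF p_inc that] unfolding q_def by (intro max.mono) auto
  have q_lim: "(\<lambda>t. real_of_rat (q i t)) \<longlonglongrightarrow> m i" for i
  proof -
    have "(\<lambda>t. max 0 (real_of_rat (p i t))) \<longlonglongrightarrow> max 0 (m i)"
      by (intro tendsto_max tendsto_const p_lim)
    moreover have "real_of_rat (q i t) = max 0 (real_of_rat (p i t))" for t
      by (simp add: q_def max_def)
    ultimately show ?thesis
      using m_nonneg[of i] by simp
  qed
  have q_le: "real_of_rat (q i t) \<le> m i" for i t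
    by (rule incseq_le[OF _ q_lim]) (use q_mono in \<open>auto simp: incseq_def of_rat_less_eq\<close>)
  define W where "W t = (\<Sum>i<t. q i t)" for t
  \<comment> \<open>At time \<open>T\<close> no index from \<open>T\<close> on has been counted, so
    whatever is seen of these indices by time \<open>t\<close> is growth after
    \<open>T\<close>.\<close>
  have W_ge: "W T + (\<Sum>i<K. q (i + T) t) \<le> W t" if "T + K \<le> t" for T K t
  proof -
    have "W T \<le> (\<Sum>i<T. q i t)"
      unfolding W_def using that by (intro sum_mono q_mono) simp
    moreover have "(\<Sum>i<T. q i t) + (\<Sum>i<K. q (i + T) t) = (\<Sum>i<T + K. q i t)"
      by (induction K) (auto simp: add.commute add.left_commute)
    moreover have "(\<Sum>i<T + K. q i t) \<le> W t"
      unfolding W_def using that q_nonneg by (intro sum_mono2) auto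
    ultimately show ?thesis
      by linarith
  qed
  have W_Suc: "W t \<le> W (Suc t)" for t
    using W_ge[of t 0 "Suc t"] by simp
  have W_le1: "real_of_rat (W t) \<le> 1" for t
  proof -
    have "real_of_rat (W t) \<le> (\<Sum>i<t. m i)"
      unfolding W_def of_rat_sum by (intro sum_mono q_le)
    also have "\<dots> \<le> (\<Sum>i. m i)"
      using m_nonneg by (intro sum_le_suminf m_summable) auto
    finally show ?thesis
      using m_le1 by (rule order_trans)
  qed
  \<comment> \<open>The advances at level \<open>n\<close> have total length at most
    \<open>e n\<close> and the extensions to the left at most \<open>2 * e n\<close>; together this
    is \<open>3 * e n\<close>, below \<open>1 / 2 ^ n\<close>.\<close>
  define e where "e n = (1 / 2 ^ (n + 2) :: rat)" for n :: nat
  have e_pos: "0 < e n" for n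
    by (simp add: e_def)
  \<comment> \<open>The closed form is computable by \<open>computable_rat_fn_Max\<close>, which
    avoids a recursion with rational values.\<close>
  define x where "x n t = Max ((\<lambda>j. s j + e n * (W t - W j)) ` {..t})" for n t
  \<comment> \<open>The frontier may equal \<open>\<alpha>\<close> before the advance. Extending the
    interval to the left by \<open>e n / 2 ^ t\<close> puts \<open>\<alpha>\<close> strictly
    inside.\<close>
  define a where "a n t = x n t - 1 / 2 ^ (n + 2 + t)" for n t
  define b where "b n t = x n t + e n * (W (Suc t) - W t)" for n t
  define U where "U n = (\<Union>t. {real_of_rat (a n t)<..<real_of_rat (b n t)})" for n

  have W: "computable_rat_fn k (\<lambda>xs. W (g xs))" if "total_recursive k g" for k g
    unfolding W_def q_def
    by (intro computable_rat_fn_intros computable_rat_fn_subst2[OF p[unfolded computable_rat_seq2_def]]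
        total_recursive_tl that total_recursive_intros
        computable_rat_fn_of_nat[of _ "\<lambda>_. 0", simplified]) simp_all
  have x: "computable_rat_fn 2 (\<lambda>xs. x (xs ! 0) (xs ! 1))"
    unfolding x_def e_def s_def
    by (intro computable_rat_fn_Max computable_rat_fn_intros W
        computable_rat_fn_partial_sum[OF r] total_recursive_intros) simp_all
  have "computable_rat_seq2 a" "computable_rat_seq2 b"
    unfolding computable_rat_seq2_def a_def b_def e_def
    by (intro x computable_rat_fn_intros W total_recursive_intros; simp)+
  then have "uniformly_effectively_open U"
    unfolding uniformly_effectively_open_def U_def by blast
  moreover have "emeasure lborel (U n) \<le> ennreal (1 / 2 ^ n)" for n
    unfolding U_def
  proof (rule emeasure_UN_intervals_le)
    fix t
    have "0 \<le> e n * (W (Suc t) - W t)" "(0 :: rat) \<le> 1 / 2 ^ (n + 2 + t)"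
      using e_pos[of n] W_Suc[of t] by simp_all
    then show "real_of_rat (a n t) \<le> real_of_rat (b n t)"
      unfolding a_def b_def of_rat_less_eq by linarith
  next
    fix K
    \<comment> \<open>The advances telescope, with \<open>W 0 = 0\<close>, and the extensions form a
      geometric series.\<close>
    have "(\<Sum>t<K. b n t - a n t) = e n * W K + 2 * e n * (1 - 1 / 2 ^ K)"
    proof (induction K)
      case 0
      then show ?case
        by (simp add: W_def)
    next
      case (Suc K)
      have "b n K - a n K = e n * (W (Suc K) - W K) + e n / 2 ^ K"
        by (simp add: a_def b_def e_def power_add)
      with Suc show ?case
        by (simp add: field_simps)
    qed
    also have "\<dots> \<le> e n * 1 + 2 * e n * 1"
    proof (intro add_mono mult_left_mono)
      show "W K \<le> 1"
        using W_le1[of K] by (metis of_rat_1 of_rat_less_eq)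
    qed (use e_pos[of n] in auto)
    also have "\<dots> \<le> 1 / 2 ^ n"
      by (simp add: e_def power_add field_simps)
    finally have "real_of_rat (\<Sum>t<K. b n t - a n t) \<le> real_of_rat (1 / 2 ^ n)"
      by (simp only: of_rat_less_eq)
    then show "(\<Sum>t<K. real_of_rat (b n t) - real_of_rat (a n t)) \<le> 1 / 2 ^ n"
      by (simp add: of_rat_sum of_rat_diff of_rat_divide of_rat_power)
  qed
  ultimately have "martin_loef_test U"
    unfolding martin_loef_test_def by blast
  moreover have "\<alpha> \<in> U n" for n
  proof -
    define \<epsilon> where "\<epsilon> = real_of_rat (e n)"
    have \<epsilon>: "0 < \<epsilon>"
      using e_pos by (simp add: \<epsilon>_def)
    \<comment> \<open>This threshold enters the analysis only; the test has been defined without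
      it.\<close>
    obtain T where T: "\<And>i. T \<le> i \<Longrightarrow> real_of_rat (r i) < \<epsilon> * m i"
      using small[OF \<epsilon>] unfolding eventually_sequentially by blast
    have tail: "(\<lambda>i. real_of_rat (r (i + T))) sums (\<alpha> - real_of_rat (s T))"
      using sums_split_initial_segment[OF sums, of T] by (simp add: s_def of_rat_sum)
    have m_tail: "summable (\<lambda>i. m (i + T))"
      using m_summable by (rule summable_ignore_initial_segment)
    \<comment> \<open>All terms are positive, so the comparison of the tails is strict. Strictness
      lets it persist first for finitely many indices \<open>K\<close>, then at a finite stage
      \<open>t\<close> of the enumeration.\<close>
    have "0 < (\<Sum>i. \<epsilon> * m (i + T) - real_of_rat (r (i + T)))"
      using T by (intro suminf_pos summable_diff summable_mult m_tail sums_summable[OF tail]) simp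
    also have "\<dots> = \<epsilon> * (\<Sum>i. m (i + T)) - (\<alpha> - real_of_rat (s T))"
      using sums_unique[OF tail] suminf_mult[OF m_tail, of \<epsilon>]
      by (subst suminf_diff[symmetric]) (simp_all add: m_summable sums_summable[OF tail])
    finally have "\<alpha> - real_of_rat (s T) < \<epsilon> * (\<Sum>i. m (i + T))"
      by simp
    moreover have "(\<lambda>K. \<epsilon> * (\<Sum>i<K. m (i + T))) \<longlonglongrightarrow> \<epsilon> * (\<Sum>i. m (i + T))"
      by (intro tendsto_intros summable_LIMSEQ m_tail)
    ultimately have "\<forall>\<^sub>F K in sequentially. \<alpha> - real_of_rat (s T) < \<epsilon> * (\<Sum>i<K. m (i + T))"
      by (rule order_tendstoD(1)[rotated])
    then obtain K where K: "\<alpha> - real_of_rat (s T) < \<epsilon> * (\<Sum>i<K. m (i + T))"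
      using eventually_happens'[OF sequentially_bot] by blast
    have "(\<lambda>t. \<epsilon> * (\<Sum>i<K. real_of_rat (q (i + T) t))) \<longlonglongrightarrow> \<epsilon> * (\<Sum>i<K. m (i + T))"
      by (intro tendsto_intros q_lim)
    then have "\<forall>\<^sub>F t in sequentially. \<alpha> - real_of_rat (s T) < \<epsilon> * (\<Sum>i<K. real_of_rat (q (i + T) t))"
      using K by (rule order_tendstoD(1))
    \<comment> \<open>The stage must also be at least \<open>T + K\<close>, so that
      \<open>W t\<close> counts all \<open>K\<close> indices concerned.\<close>
    then have "\<forall>\<^sub>F t in sequentially.
        \<alpha> - real_of_rat (s T) < \<epsilon> * (\<Sum>i<K. real_of_rat (q (i + T) t)) \<and> T + K \<le> t"
      using eventually_ge_at_top by (rule eventually_conj)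
    then obtain t where t: "\<alpha> - real_of_rat (s T) < \<epsilon> * (\<Sum>i<K. real_of_rat (q (i + T) t))"
      and Kt: "T + K \<le> t"
      using eventually_happens'[OF sequentially_bot] by blast
    have "real_of_rat (\<Sum>i<K. q (i + T) t) \<le> real_of_rat (W t - W T)"
      using W_ge[OF Kt] unfolding of_rat_less_eq by linarith
    then have "(\<Sum>i<K. real_of_rat (q (i + T) t)) \<le> real_of_rat (W t - W T)"
      by (simp only: of_rat_sum)
    then have "\<epsilon> * (\<Sum>i<K. real_of_rat (q (i + T) t)) \<le> \<epsilon> * real_of_rat (W t - W T)"
      using \<epsilon> by (intro mult_left_mono) auto
    with t have "\<alpha> < real_of_rat (s T + e n * (W t - W T))"
      by (simp add: of_rat_add of_rat_mult \<epsilon>_def)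
    then obtain u where u: "real_of_rat (x n u) \<le> \<alpha>"
        "\<alpha> < real_of_rat (x n u + e n * (W (Suc u) - W u))"
      using frontier_crossing[of "x n" s "e n" W \<alpha> T t] s_le Kt x_def by auto
    have "a n u < x n u"
      by (simp add: a_def)
    then have "real_of_rat (a n u) < real_of_rat (x n u)"
      by (simp only: of_rat_less)
    then have "\<alpha> \<in> {real_of_rat (a n u)<..<real_of_rat (b n u)}"
      using u by (simp add: b_def)
    then show ?thesis
      unfolding U_def by blast
  qed
  ultimately show ?thesis
    unfolding martin_loef_random_def by blast
qed

theorem theorem9:
  fixes m :: "nat \<Rightarrow> real" and r :: "nat \<Rightarrow> rat" and \<alpha> :: real
  assumes "universal_semimeasure m"
    and "computable_rat_seq r"
    and "\<And>i. r i > 0"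
    and "(\<lambda>i. real_of_rat (r i)) sums \<alpha>"
  shows "(martin_loef_random \<alpha> \<longleftrightarrow> solovay_slow m r) \<and>
    (\<not> martin_loef_random \<alpha> \<longleftrightarrow> (\<lambda>i. real_of_rat (r i) / m i) \<longlonglongrightarrow> 0)"
proof -
  let ?small = "\<forall>\<epsilon>>0. \<forall>\<^sub>F i in sequentially. real_of_rat (r i) < \<epsilon> * m i"
  \<comment> \<open>On the naturals the cofinite filter is \<open>sequentially\<close>, so the
    negation of "infinitely often" is an eventual strict inequality.\<close>
  have not_slow: "\<not> solovay_slow m r \<longleftrightarrow> ?small"
    unfolding solovay_slow_def frequently_cofinite[symmetric] cofinite_eq_sequentially
    by (simp add: not_frequently not_le)
  have m: "0 < m i" for i
    using assms(1) by (rule universal_semimeasure_pos)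
  have "real_of_rat (r i) < \<epsilon> * m i \<longleftrightarrow> dist (real_of_rat (r i) / m i) 0 < \<epsilon>" for i \<epsilon>
    using m[of i] assms(3)[of i] by (simp add: pos_divide_less_eq)
  then have "?small \<longleftrightarrow> (\<lambda>i. real_of_rat (r i) / m i) \<longlonglongrightarrow> 0"
    unfolding tendsto_iff by simp
  moreover have "\<not> martin_loef_random \<alpha> \<longleftrightarrow> ?small"
    using eventually_less_universal_if_in_test[OF assms]
      not_random_if_not_slow[OF _ assms(2-4)] assms(1)
    unfolding martin_loef_random_def universal_semimeasure_def by blast
  ultimately show ?thesis
    using not_slow by blast
qed

end
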